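(* For every $n\ge 1$, the $\mathbb{Q}$-algebra $\sum_W(A_n)$ is commutative.
   Context: Let $e_1,\dots,e_{n+1}$ be an orthonormal basis of a Euclidean space of dimension $n+1$. The root system of type $A_n$ is $\Phi=\{e_i-e_j\mid i\ne j,\ 1\le i,j\le n+1\}$ with fundamental system $\Pi=\{e_1-e_2,\dots,e_n-e_{n+1}\}$ and corresponding positive system $\Phi^+$; $W=W(A_n)$ is the group generated by the reflections $w_r$, $r\in\Phi$. For $J\subseteq\Pi$, $W_J$ is the standard parabolic subgroup generated by the $w_r$, $r\in J$, and $X_J=\{w\in W\mid w(J)\subseteq\Phi^+\}$ is the set of distinguished (minimal length) representatives of the left cosets $wW_J$ in $W$. Put $X_J^{-1}=\{w^{-1}\mid w\in X_J\}$ and $X_{JK}=X_J^{-1}\cap X_K$. Let $x_J=\sum_{d\in X_J}d\in\mathbb{Q}W$. For $J,K,L\subseteq\Pi$, $a_{JKL}$ is the number of $w\in X_{JK}$ with $w^{-1}(J)\cap K=L$. Write $J\sim K$ if $w(J)=K$ for some $w\in W$; define $x_J\sim x_K$ if and only if $J\sim K$, and let $[x_J]=\{x_K\mid K\subseteq\Pi,\ K\sim J\}$ be the equivalence class of $x_J$. The new descent algebra $\sum_W(A_n)$ is the $\mathbb{Q}$-vector space having as basis the distinct classes $[x_J]$, $J\subseteq\Pi$, with the (well-defined) bilinear multiplication $[x_J][x_K]=\sum_{L\subseteq K}a_{JKL}[x_L]$ and identity $[x_\Pi]$. *)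

theory Defs
  imports
    "HOL-Analysis.Analysis"
    "HOL-Algebra.Bij"
    "HOL-Algebra.Generated_Groups"
    "HOL-Algebra.Module"
    "HOL-Library.Poly_Mapping"
begin

unbundle no m_inv_syntax

section \<open>Root system, Weyl group and distinguished coset representatives\<close>

text \<open>Everything below takes the rank \<open>n\<close> and the vectors \<open>e 1, \<dots>, e (n + 1)\<close> as parameters;
  \<open>e\<close> is meant to enumerate an orthonormal basis there, and its other values are never used.\<close>

definition A_roots :: "nat \<Rightarrow> (nat \<Rightarrow> 'a::euclidean_space) \<Rightarrow> 'a set" where
  "A_roots n e = {e i - e j | i j. i \<in> {1..n+1} \<and> j \<in> {1..n+1} \<and> i \<noteq> j}"

definition A_simple :: "nat \<Rightarrow> (nat \<Rightarrow> 'a::euclidean_space) \<Rightarrow> 'a set" where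
  "A_simple n e = {e i - e (i+1) | i. i \<in> {1..n}}"

definition A_pos :: "nat \<Rightarrow> (nat \<Rightarrow> 'a::euclidean_space) \<Rightarrow> 'a set" where
  "A_pos n e = {r \<in> A_roots n e.
     \<exists>c. (\<forall>s\<in>A_simple n e. 0 \<le> c s) \<and> r = (\<Sum>s\<in>A_simple n e. c s *\<^sub>R s)}"

definition reflection :: "'a::real_inner \<Rightarrow> 'a \<Rightarrow> 'a" where
  "reflection r v = v - (2 * (v \<bullet> r) / (r \<bullet> r)) *\<^sub>R r"

definition weyl_A :: "nat \<Rightarrow> (nat \<Rightarrow> 'a::euclidean_space) \<Rightarrow> ('a \<Rightarrow> 'a) set" where
  "weyl_A n e = generate (BijGroup UNIV) (reflection ` A_roots n e)"

definition dist_reps :: "nat \<Rightarrow> (nat \<Rightarrow> 'a::euclidean_space) \<Rightarrow> 'a set \<Rightarrow> ('a \<Rightarrow> 'a) set" where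
  "dist_reps n e J = {w \<in> weyl_A n e. w ` J \<subseteq> A_pos n e}"

definition double_reps ::
    "nat \<Rightarrow> (nat \<Rightarrow> 'a::euclidean_space) \<Rightarrow> 'a set \<Rightarrow> 'a set \<Rightarrow> ('a \<Rightarrow> 'a) set" where
  "double_reps n e J K = inv ` dist_reps n e J \<inter> dist_reps n e K"

definition desc_coeff ::
    "nat \<Rightarrow> (nat \<Rightarrow> 'a::euclidean_space) \<Rightarrow> 'a set \<Rightarrow> 'a set \<Rightarrow> 'a set \<Rightarrow> nat" where
  "desc_coeff n e J K L = card {w \<in> double_reps n e J K. inv w ` J \<inter> K = L}"

section \<open>The new descent algebra\<close>

text \<open>Elements of the rational group algebra of \<open>W\<close>, and of the rational vector space on the classes
  \<open>[x_J]\<close>, are finitely supported functions (\<open>Poly_Mapping\<close>). The ring structure that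
  \<open>Poly_Mapping\<close> may put on such functions is not used.\<close>

definition desc_elt ::
    "nat \<Rightarrow> (nat \<Rightarrow> 'a::euclidean_space) \<Rightarrow> 'a set \<Rightarrow> ('a \<Rightarrow> 'a) \<Rightarrow>\<^sub>0 rat" where
  "desc_elt n e J = (\<Sum>d\<in>dist_reps n e J. Poly_Mapping.single d 1)"

definition simple_conj :: "nat \<Rightarrow> (nat \<Rightarrow> 'a::euclidean_space) \<Rightarrow> 'a set \<Rightarrow> 'a set \<Rightarrow> bool" where
  "simple_conj n e J K \<longleftrightarrow> (\<exists>w\<in>weyl_A n e. w ` J = K)"

definition desc_class ::
    "nat \<Rightarrow> (nat \<Rightarrow> 'a::euclidean_space) \<Rightarrow> 'a set \<Rightarrow> (('a \<Rightarrow> 'a) \<Rightarrow>\<^sub>0 rat) set" where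
  "desc_class n e J = {desc_elt n e K | K. K \<subseteq> A_simple n e \<and> simple_conj n e K J}"

definition desc_classes ::
    "nat \<Rightarrow> (nat \<Rightarrow> 'a::euclidean_space) \<Rightarrow> (('a \<Rightarrow> 'a) \<Rightarrow>\<^sub>0 rat) set set" where
  "desc_classes n e = desc_class n e ` Pow (A_simple n e)"

definition desc_scale :: "rat \<Rightarrow> ('c \<Rightarrow>\<^sub>0 rat) \<Rightarrow> ('c \<Rightarrow>\<^sub>0 rat)" where
  "desc_scale c p = Poly_Mapping.map ((*) c) p"

definition desc_prod ::
    "nat \<Rightarrow> (nat \<Rightarrow> 'a::euclidean_space) \<Rightarrow> 'a set \<Rightarrow> 'a set \<Rightarrow>
      (('a \<Rightarrow> 'a) \<Rightarrow>\<^sub>0 rat) set \<Rightarrow>\<^sub>0 rat" where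
  "desc_prod n e J K =
    (\<Sum>L\<in>Pow K. Poly_Mapping.single (desc_class n e L) (of_nat (desc_coeff n e J K L)))"

definition desc_rep ::
    "nat \<Rightarrow> (nat \<Rightarrow> 'a::euclidean_space) \<Rightarrow> (('a \<Rightarrow> 'a) \<Rightarrow>\<^sub>0 rat) set \<Rightarrow> 'a set" where
  "desc_rep n e A = (SOME J. J \<subseteq> A_simple n e \<and> desc_class n e J = A)"

text \<open>The product of two classes is computed from chosen representatives; it does not depend on
  the choice, see the lemma \<open>new_descent_algebra_mult_basis\<close> below.\<close>

definition new_descent_algebra ::
    "nat \<Rightarrow> (nat \<Rightarrow> 'a::euclidean_space) \<Rightarrow> (rat, (('a \<Rightarrow> 'a) \<Rightarrow>\<^sub>0 rat) set \<Rightarrow>\<^sub>0 rat) module" where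
  "new_descent_algebra n e =
    \<lparr>carrier = {p. Poly_Mapping.keys p \<subseteq> desc_classes n e},
     mult = (\<lambda>p q. \<Sum>A\<in>Poly_Mapping.keys p. \<Sum>B\<in>Poly_Mapping.keys q.
       desc_scale (Poly_Mapping.lookup p A * Poly_Mapping.lookup q B)
         (desc_prod n e (desc_rep n e A) (desc_rep n e B))),
     one = Poly_Mapping.single (desc_class n e (A_simple n e)) 1,
     zero = 0,
     add = (+),
     smult = desc_scale\<rparr>"

section \<open>Well-definedness of the multiplication\<close>

locale type_A_basis =
  fixes n :: nat and e :: "nat \<Rightarrow> 'a::euclidean_space"
  assumes dim: "DIM('a) = n + 1"
    and orthonormal: "\<forall>i\<in>{1..n+1}. \<forall>j\<in>{1..n+1}. e i \<bullet> e j = (if i = j then 1 else 0)"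
begin

abbreviation "\<Phi> \<equiv> A_roots n e"
abbreviation "\<Delta> \<equiv> A_simple n e"
abbreviation "\<Phi>p \<equiv> A_pos n e"
abbreviation "W \<equiv> weyl_A n e"

definition ht :: 'a where "ht = (\<Sum>i\<in>{1..n+1}. - real i *\<^sub>R e i)"

lemma inner_e: "i \<in> {1..n+1} \<Longrightarrow> j \<in> {1..n+1} \<Longrightarrow> e i \<bullet> e j = (if i = j then 1 else 0)"
  using orthonormal by blast

lemma inj_e: "inj_on e {1..n+1}"
proof (rule inj_onI)
  fix i j assume "i \<in> {1..n+1}" "j \<in> {1..n+1}" "e i = e j"
  then show "i = j" using inner_e[of i j] inner_e[of i i] by (auto split: if_splits)
qed

lemma span_e: "span (e ` {1..n+1}) = UNIV"
proof -
  have ind: "independent (e ` {1..n+1})"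
  proof (rule pairwise_orthogonal_independent)
    show "pairwise orthogonal (e ` {1..n+1})"
      unfolding pairwise_def orthogonal_def
    proof (intro ballI impI)
      fix x y assume xy: "x \<in> e ` {1..n+1}" "y \<in> e ` {1..n+1}" "x \<noteq> y"
      then obtain i j where ij: "x = e i" "i \<in> {1..n+1}" "y = e j" "j \<in> {1..n+1}" by blast
      then have "i \<noteq> j" using xy by auto
      then show "x \<bullet> y = 0" using inner_e[OF ij(2,4)] ij(1,3) by simp
    qed
    show "0 \<notin> e ` {1..n+1}"
    proof
      assume "0 \<in> e ` {1..n+1}"
      then obtain i where i: "0 = e i" "i \<in> {1..n+1}" by blast
      show False using inner_e[OF i(2,2)] i(1)[symmetric] by simp
    qed
  qed
  have "UNIV \<subseteq> span (e ` {1..n+1})"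
    by (rule card_ge_dim_independent) (use ind dim card_image[OF inj_e] in auto)
  then show ?thesis by auto
qed

lemma inner_e_ht: "k \<in> {1..n+1} \<Longrightarrow> e k \<bullet> ht = - real k"
proof -
  assume k: "k \<in> {1..n+1}"
  have "e k \<bullet> ht = (\<Sum>i\<in>{1..n+1}. - real i * (e k \<bullet> e i))"
    unfolding ht_def inner_sum_right by simp
  also have "\<dots> = (\<Sum>i\<in>{1..n+1}. if k = i then - real i else 0)"
    by (rule sum.cong) (use k inner_e in auto)
  also have "\<dots> = - real k" using k by simp
  finally show ?thesis .
qed

lemma root_ht: "i \<in> {1..n+1} \<Longrightarrow> j \<in> {1..n+1} \<Longrightarrow> (e i - e j) \<bullet> ht = real j - real i"
  by (simp add: inner_diff_left inner_e_ht)

lemma rootE: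
  assumes "r \<in> \<Phi>"
  obtains i j where "r = e i - e j" "i \<in> {1..n+1}" "j \<in> {1..n+1}" "i \<noteq> j"
  using assms unfolding A_roots_def by blast

lemma finite_roots [simp]: "finite \<Phi>"
proof -
  have "\<Phi> \<subseteq> (\<lambda>(i,j). e i - e j) ` ({1..n+1} \<times> {1..n+1})"
    unfolding A_roots_def by auto
  then show ?thesis by (rule finite_subset) auto
qed

lemma simple_roots: "\<Delta> \<subseteq> \<Phi>"
  unfolding A_simple_def A_roots_def by fastforce

lemma finite_simple [simp]: "finite \<Delta>"
  using finite_subset[OF simple_roots] by simp

lemma simple_ht: "s \<in> \<Delta> \<Longrightarrow> s \<bullet> ht = 1"
  unfolding A_simple_def using root_ht by force

lemma root_sum_simple:
  "a \<le> b \<Longrightarrow> e a - e b = (\<Sum>i\<in>{a..<b}. e i - e (i+1))"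
  using sum_Suc_diff'[of a b "\<lambda>i. - e i"] by simp

lemma inj_simple: "inj_on (\<lambda>i. e i - e (i+1)) {1..n}"
proof (rule inj_onI)
  fix i j assume ij: "i \<in> {1..n}" "j \<in> {1..n}" "e i - e (i+1) = e j - e (j+1)"
  have "(e i - e (i+1)) \<bullet> e i = 1" using ij(1) by (simp add: inner_diff_left inner_e)
  then have *: "(e j - e (j+1)) \<bullet> e i = 1" using ij by simp
  show "i = j"
  proof (rule ccontr)
    assume "i \<noteq> j"
    then have "(e j - e (j+1)) \<bullet> e i \<le> 0" using ij(1,2) by (simp add: inner_diff_left inner_e)
    with * show False by simp
  qed
qed

lemma pos_iff: "r \<in> \<Phi>p \<longleftrightarrow> r \<in> \<Phi> \<and> r \<bullet> ht > 0"
proof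
  assume r: "r \<in> \<Phi>p"
  then obtain c where c: "\<forall>s\<in>\<Delta>. 0 \<le> c s" "r = (\<Sum>s\<in>\<Delta>. c s *\<^sub>R s)" and R: "r \<in> \<Phi>"
    unfolding A_pos_def by blast
  have "r \<bullet> ht = (\<Sum>s\<in>\<Delta>. c s)" unfolding c(2) inner_sum_left
    by (rule sum.cong) (auto simp: simple_ht)
  then have "r \<bullet> ht \<ge> 0" using c(1) by (simp add: sum_nonneg)
  moreover have "r \<bullet> ht \<noteq> 0" using R by (auto elim!: rootE simp: root_ht)
  ultimately show "r \<in> \<Phi> \<and> r \<bullet> ht > 0" using R by simp
next
  assume r: "r \<in> \<Phi> \<and> r \<bullet> ht > 0"
  then obtain i j where ij: "r = e i - e j" "i \<in> {1..n+1}" "j \<in> {1..n+1}" "i \<noteq> j" by (auto elim: rootE)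
  with r have lt: "i < j" by (simp add: root_ht)
  let ?f = "\<lambda>i. e i - e (i+1)"
  define A where "A = ?f ` {i..<j}"
  let ?c = "\<lambda>s. if s \<in> A then 1 else (0::real)"
  have sub: "{i..<j} \<subseteq> {1..n}" using ij lt by auto
  have D: "\<Delta> = ?f ` {1..n}" unfolding A_simple_def by auto
  have "(\<Sum>s\<in>\<Delta>. ?c s *\<^sub>R s) = (\<Sum>s\<in>A. s)"
    by (rule sum.mono_neutral_cong_right) (use sub D A_def in auto)
  also have "\<dots> = (\<Sum>k\<in>{i..<j}. ?f k)"
    unfolding A_def by (subst sum.reindex) (use inj_on_subset[OF inj_simple sub] in auto)
  also have "\<dots> = r" using root_sum_simple[of i j] lt ij by simp
  finally have "r = (\<Sum>s\<in>\<Delta>. ?c s *\<^sub>R s)" by (rule sym)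
  moreover have "\<forall>s\<in>\<Delta>. 0 \<le> ?c s" by simp
  ultimately have "\<exists>c. (\<forall>s\<in>\<Delta>. 0 \<le> c s) \<and> r = (\<Sum>s\<in>\<Delta>. c s *\<^sub>R s)"
    by (intro exI[of _ ?c]) (rule conjI)
  with r show "r \<in> \<Phi>p" unfolding A_pos_def by simp
qed

lemma simple_pos: "\<Delta> \<subseteq> \<Phi>p"
  using simple_roots simple_ht pos_iff by force

lemma uminus_root: "r \<in> \<Phi> \<Longrightarrow> - r \<in> \<Phi>"
  by (elim rootE) (auto simp: A_roots_def)

lemma root_cases: "r \<in> \<Phi> \<Longrightarrow> r \<in> \<Phi>p \<or> - r \<in> \<Phi>p"
proof -
  assume r: "r \<in> \<Phi>"
  then have "r \<bullet> ht \<noteq> 0" by (elim rootE) (simp add: root_ht)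
  then show ?thesis using r uminus_root[OF r] by (auto simp: pos_iff)
qed

lemma posE:
  assumes "r \<in> \<Phi>p"
  obtains a b where "r = e a - e b" "1 \<le> a" "a < b" "b \<le> n+1"
proof -
  have r: "r \<in> \<Phi>" "r \<bullet> ht > 0" using assms pos_iff by auto
  from r(1) show thesis
  proof (rule rootE)
    fix i j assume ij: "r = e i - e j" "i \<in> {1..n+1}" "j \<in> {1..n+1}" "i \<noteq> j"
    then have "i < j" using r(2) by (simp add: root_ht)
    then show thesis using that[of i j] ij by simp
  qed
qed

lemma pos_ht_ge1: "r \<in> \<Phi>p \<Longrightarrow> r \<bullet> ht \<ge> 1"
  by (elim posE) (simp add: root_ht)

text \<open>Simple roots occurring in a positive root of \<open>span K\<close> belong to \<open>K\<close>.\<close>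

lemma span_simple:
  assumes K: "K \<subseteq> \<Delta>" and ab: "1 \<le> a" "a < b" "b \<le> n+1" and sp: "e a - e b \<in> span K"
    and i: "i \<in> {a..<b}"
  shows "e i - e (i+1) \<in> K"
proof (rule ccontr)
  assume nK: "e i - e (i+1) \<notin> K"
  define om where "om = (\<Sum>j\<in>{1..i}. e j)"
  have om: "e k \<bullet> om = (if k \<le> i then 1 else 0)" if "k \<in> {1..n+1}" for k
  proof -
    have "e k \<bullet> om = (\<Sum>j\<in>{1..i}. if k = j then 1 else 0)"
      unfolding om_def inner_sum_right by (rule sum.cong) (use that i ab inner_e in auto)
    then show ?thesis using that by simp
  qed
  have "om \<bullet> x = 0" if "x \<in> K" for x
  proof -
    obtain k where k: "x = e k - e (k+1)" "k \<in> {1..n}" using K \<open>x \<in> K\<close> unfolding A_simple_def by auto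
    moreover have "k \<noteq> i" using nK k that by auto
    ultimately show ?thesis by (auto simp: inner_diff_right inner_commute[of om] om)
  qed
  then have "om \<bullet> (e a - e b) = 0"
    using sp orthogonal_to_span[of "e a - e b" K om] by (auto simp: orthogonal_def)
  moreover have "om \<bullet> (e a - e b) = 1"
    using ab i by (auto simp: inner_diff_right inner_commute[of om] om)
  ultimately show False by simp
qed

subsection \<open>Weyl group\<close>

lemma bij_group_mult: "bij f \<Longrightarrow> bij g \<Longrightarrow> f \<otimes>\<^bsub>BijGroup UNIV\<^esub> g = f \<circ> g"
  by (auto simp: BijGroup_def Bij_def compose_def)

lemma bij_group_carrier: "carrier (BijGroup UNIV) = {f. bij f}"
  by (auto simp: BijGroup_def Bij_def)

lemma bij_group_one: "\<one>\<^bsub>BijGroup UNIV\<^esub> = id"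
  by (auto simp: BijGroup_def)

lemma bij_group_inv: "bij f \<Longrightarrow> m_inv (BijGroup UNIV) f = inv f"
  by (rule group.inv_equality[OF group_BijGroup])
    (auto simp: bij_group_mult bij_group_one bij_group_carrier bij_imp_bij_inv bij_is_inj)

lemma reflection_linear: "linear (reflection r)"
  unfolding reflection_def
  by (rule linearI) (auto simp: inner_add_left algebra_simps add_divide_distrib)

lemma reflection_invol: "reflection r (reflection r v) = v"
  unfolding reflection_def by (cases "r = 0") (auto simp: inner_diff_left algebra_simps)

lemma reflection_bij: "bij (reflection r)"
  by (rule involuntory_imp_bij) (rule reflection_invol)

lemma inv_reflection: "inv (reflection r) = reflection r"
  by (rule inv_unique_comp) (auto simp: reflection_invol)

lemma root_norm: "r \<in> \<Phi> \<Longrightarrow> r \<bullet> r = 2"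
  by (elim rootE) (auto simp: inner_diff_left inner_diff_right inner_e)

lemma reflection_e:
  assumes "i \<in> {1..n+1}" "j \<in> {1..n+1}" "i \<noteq> j" "k \<in> {1..n+1}"
  shows "reflection (e i - e j) (e k) = e (if k = i then j else if k = j then i else k)"
proof -
  have "e i - e j \<in> \<Phi>" using assms unfolding A_roots_def by auto
  then have "reflection (e i - e j) (e k) = e k - (e k \<bullet> (e i - e j)) *\<^sub>R (e i - e j)"
    unfolding reflection_def by (simp add: root_norm)
  also have "\<dots> = e (if k = i then j else if k = j then i else k)"
    using assms by (auto simp: inner_diff_right inner_e)
  finally show ?thesis .
qed

lemma W_bij: "w \<in> W \<Longrightarrow> bij w"
  using group.generate_in_carrier[OF group_BijGroup, of "reflection ` \<Phi>" UNIV w]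
  by (simp add: weyl_A_def bij_group_carrier reflection_bij image_subset_iff)

lemma W_id: "id \<in> W"
  using generate.one[of "BijGroup UNIV"] unfolding weyl_A_def bij_group_one by blast

lemma W_refl: "r \<in> \<Phi> \<Longrightarrow> reflection r \<in> W"
  unfolding weyl_A_def by (rule generate.incl) auto

lemma W_comp: "u \<in> W \<Longrightarrow> w \<in> W \<Longrightarrow> u \<circ> w \<in> W"
  using generate.eng[of u "BijGroup UNIV" "reflection ` \<Phi>" w] W_bij[of u] W_bij[of w]
  by (simp add: weyl_A_def bij_group_mult)

lemma W_inv: "w \<in> W \<Longrightarrow> inv w \<in> W"
  using group.generate_m_inv_closed[OF group_BijGroup, of "reflection ` \<Phi>" UNIV w] W_bij[of w]
  by (simp add: weyl_A_def bij_group_inv bij_group_carrier reflection_bij image_subset_iff)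

lemma reflection_perm:
  assumes "r \<in> \<Phi>" "k \<in> {1..n+1}"
  shows "reflection r (e k) \<in> e ` {1..n+1}"
  using assms(1)
proof (rule rootE)
  fix i j assume ij: "r = e i - e j" "i \<in> {1..n+1}" "j \<in> {1..n+1}" "i \<noteq> j"
  have "(if k = i then j else if k = j then i else k) \<in> {1..n+1}" using ij assms(2) by presburger
  then show ?thesis unfolding ij(1) reflection_e[OF ij(2-4) assms(2)] by (rule imageI)
qed

lemma W_linear_perm:
  assumes "w \<in> W"
  shows "linear w \<and> (\<forall>k\<in>{1..n+1}. w (e k) \<in> e ` {1..n+1})"
  using assms unfolding weyl_A_def
proof (induction rule: generate.induct)
  case one
  then show ?case unfolding bij_group_one by (intro conjI ballI) (rule linear_id, simp)
next
  case (incl h)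
  then show ?case using reflection_linear reflection_perm by blast
next
  case (inv h)
  then obtain r where r: "h = reflection r" "r \<in> \<Phi>" by blast
  have "m_inv (BijGroup UNIV) h = h"
    unfolding r(1) bij_group_inv[OF reflection_bij] by (rule inv_reflection)
  then show ?case using r reflection_linear reflection_perm by metis
next
  case (eng h1 h2)
  note b = W_bij[unfolded weyl_A_def, OF eng.hyps(1)] W_bij[unfolded weyl_A_def, OF eng.hyps(2)]
  from b have eq: "h1 \<otimes>\<^bsub>BijGroup UNIV\<^esub> h2 = h1 \<circ> h2" by (rule bij_group_mult)
  have "(h1 \<circ> h2) (e k) \<in> e ` {1..n+1}" if "k \<in> {1..n+1}" for k
  proof -
    have "h2 (e k) \<in> e ` {1..n+1}" using eng.IH(2) that by (rule conjunct2[THEN bspec])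
    then obtain l where l: "h2 (e k) = e l" "l \<in> {1..n+1}" by (rule imageE)
    show ?thesis unfolding comp_apply l(1) using eng.IH(1) l(2) by (rule conjunct2[THEN bspec])
  qed
  moreover have "linear (h1 \<circ> h2)" using linear_compose[OF conjunct1[OF eng.IH(2)] conjunct1[OF eng.IH(1)]] .
  ultimately show ?case unfolding eq by blast
qed

lemma W_linear: "w \<in> W \<Longrightarrow> linear w"
  and W_perm: "w \<in> W \<Longrightarrow> k \<in> {1..n+1} \<Longrightarrow> \<exists>l\<in>{1..n+1}. w (e k) = e l"
  using W_linear_perm by blast+

lemma W_inv1 [simp]: "w \<in> W \<Longrightarrow> inv w (w x) = x"
  and W_inv2 [simp]: "w \<in> W \<Longrightarrow> w (inv w x) = x"
  using W_bij by (auto simp: bij_is_inj bij_is_surj surj_f_inv_f)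

lemma W_root: "w \<in> W \<Longrightarrow> r \<in> \<Phi> \<Longrightarrow> w r \<in> \<Phi>"
proof (elim rootE)
  fix i j assume w: "w \<in> W" and ij: "r = e i - e j" "i \<in> {1..n+1}" "j \<in> {1..n+1}" "i \<noteq> j"
  obtain k l where kl: "k \<in> {1..n+1}" "w (e i) = e k" "l \<in> {1..n+1}" "w (e j) = e l"
    using W_perm[OF w] ij by meson
  have "e i \<noteq> e j" using inj_e ij by (auto dest: inj_onD)
  then have "e k \<noteq> e l" using kl W_inv1[OF w] by metis
  then show ?thesis using kl linear_diff[OF W_linear[OF w]] ij unfolding A_roots_def by fastforce
qed

lemma W_eqI:
  assumes "u \<in> W" "w \<in> W" "\<And>k. k \<in> {1..n+1} \<Longrightarrow> u (e k) = w (e k)"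
  shows "u = w"
proof
  fix x
  show "u x = w x"
    by (rule linear_eq_on[of u w x "e ` {1..n+1}"])
       (use assms span_e in \<open>auto simp: W_linear\<close>)
qed

lemma finite_W: "finite W"
proof -
  let ?f = "\<lambda>w. restrict w (e ` {1..n+1})"
  have "inj_on ?f W"
  proof (rule inj_onI)
    fix u w assume uw: "u \<in> W" "w \<in> W" and eq: "?f u = ?f w"
    show "u = w"
    proof (rule W_eqI[OF uw])
      fix k assume "k \<in> {1..n+1}"
      then have "e k \<in> e ` {1..n+1}" by (rule imageI)
      then show "u (e k) = w (e k)" using fun_cong[OF eq, of "e k"] by (simp only: restrict_apply if_True)
    qed
  qed
  moreover have "?f ` W \<subseteq> (e ` {1..n+1}) \<rightarrow>\<^sub>E (e ` {1..n+1})"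
    using W_linear_perm by (auto simp: PiE_def extensional_def)
  moreover have "finite ((e ` {1..n+1}) \<rightarrow>\<^sub>E (e ` {1..n+1}))" by (intro finite_PiE) auto
  ultimately show ?thesis by (meson finite_imageD finite_subset)
qed

lemma W_pos_id:
  assumes w: "w \<in> W" and pos: "\<And>s. s \<in> \<Delta> \<Longrightarrow> w s \<in> \<Phi>p"
  shows "w = id"
proof -
  obtain p where p: "\<And>k. k \<in> {1..n+1} \<Longrightarrow> p k \<in> {1..n+1} \<and> w (e k) = e (p k)"
    using W_perm[OF w] by metis
  have step: "p k < p (k+1)" if k: "k \<in> {1..n}" for k
  proof -
    have "e k - e (k+1) \<in> \<Delta>" using k unfolding A_simple_def by auto
    from pos[OF this] have "w (e k) - w (e (k+1)) \<in> \<Phi>p" by (simp add: linear_diff[OF W_linear[OF w]])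
    then have "e (p k) - e (p (k+1)) \<in> \<Phi>p" using p k by auto
    then show ?thesis using p k by (auto simp: pos_iff root_ht)
  qed
  have ge: "k \<le> n \<Longrightarrow> p (k+1) \<ge> k+1" for k
  proof (induction k)
    case 0 then show ?case using p[of 1] by auto
  next
    case (Suc k) then show ?case using step[of "k+1"] by auto
  qed
  have le: "d \<le> n \<Longrightarrow> p (n+1-d) \<le> n+1-d" for d
  proof (induction d)
    case 0 then show ?case using p[of "n+1"] by auto
  next
    case (Suc d)
    have "n + 1 - Suc d \<in> {1..n}" using Suc.prems by auto
    from step[OF this] have "p (n+1 - Suc d) < p (n + 1 - d)" using Suc.prems by (simp add: Suc_diff_le)
    with Suc show ?case by auto
  qed
  have "p k = k" if "k \<in> {1..n+1}" for k
  proof -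
    have "k - 1 \<le> n" "k - 1 + 1 = k" "n + 1 - k \<le> n" "n + 1 - (n + 1 - k) = k"
      using that by auto
    then show ?thesis using ge[of "k-1"] le[of "n+1-k"] by simp
  qed
  then show ?thesis by (intro W_eqI[OF w W_id]) (use p in auto)
qed

lemma reflection_simple:
  assumes k: "k \<in> \<Delta>" and r: "r \<in> \<Phi>p" and ne: "r \<noteq> k"
  shows "reflection k r \<in> \<Phi>p"
proof -
  have kP: "k \<in> \<Phi>" using k simple_roots by auto
  have rP: "reflection k r \<in> \<Phi>" using W_root[OF W_refl[OF kP]] r pos_iff by auto
  obtain i where i: "k = e i - e (i+1)" "i \<in> {1..n}" using k unfolding A_simple_def by auto
  obtain a b where ab: "r = e a - e b" "1 \<le> a" "a < b" "b \<le> n+1" using r by (elim posE)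
  have "reflection k r = r - (r \<bullet> k) *\<^sub>R k" unfolding reflection_def by (simp add: root_norm[OF kP])
  then have h: "reflection k r \<bullet> ht = real b - real a - r \<bullet> k"
    using ab root_ht[of a b] by (simp add: inner_diff_left[of "e a - e b"] simple_ht[OF k])
  have "\<not> (a = i \<and> b = i+1)" using ne i ab by auto
  then have "real b - real a - r \<bullet> k > 0"
    using ab i by (auto simp: inner_diff_left inner_diff_right inner_e)
  with h rP show ?thesis by (simp add: pos_iff)
qed

subsection \<open>Coset decomposition\<close>

text \<open>\<open>par K\<close> is the parabolic subgroup \<open>W_K\<close>, described by its action on the roots.\<close>

definition par :: "'a set \<Rightarrow> ('a \<Rightarrow> 'a) set" where
  "par K = {g \<in> W. (\<forall>r\<in>\<Phi>. g r \<in> span K \<longleftrightarrow> r \<in> span K) \<and>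
     (\<forall>r\<in>\<Phi>p. r \<notin> span K \<longrightarrow> g r \<in> \<Phi>p \<and> inv g r \<in> \<Phi>p)}"

lemma par_W: "g \<in> par K \<Longrightarrow> g \<in> W" by (simp add: par_def)

lemma par_id: "id \<in> par K" by (simp add: par_def W_id)

lemma par_span_inv:
  assumes "g \<in> par K" "r \<in> \<Phi>"
  shows "inv g r \<in> span K \<longleftrightarrow> r \<in> span K"
proof -
  have "inv g r \<in> \<Phi>" using W_root[OF W_inv] assms par_W by blast
  then have "g (inv g r) \<in> span K \<longleftrightarrow> inv g r \<in> span K" using assms by (auto simp: par_def)
  then show ?thesis using assms par_W by simp
qed

lemma par_inv: "g \<in> par K \<Longrightarrow> inv g \<in> par K"
  using par_span_inv[of g K] unfolding par_def
  by (auto simp: W_inv W_bij inv_inv_eq)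

lemma par_comp:
  assumes g: "g \<in> par K" and h: "h \<in> par K"
  shows "g \<circ> h \<in> par K"
proof -
  have W: "g \<in> W" "h \<in> W" using g h par_W by auto
  have "inv (g \<circ> h) = inv h \<circ> inv g" using W W_bij by (simp add: o_inv_distrib)
  moreover have "(g \<circ> h) r \<in> \<Phi>p \<and> (inv h \<circ> inv g) r \<in> \<Phi>p" if r: "r \<in> \<Phi>p" "r \<notin> span K" for r
  proof -
    have rP: "r \<in> \<Phi>" using r pos_iff by auto
    have "h r \<in> \<Phi>p" "h r \<notin> span K" using h r rP by (auto simp: par_def)
    moreover have "inv g r \<in> \<Phi>p" "inv g r \<notin> span K"
      using g r rP par_span_inv[OF g rP] by (auto simp: par_def)
    ultimately show ?thesis using g h by (auto simp: par_def)
  qed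
  moreover have "(g \<circ> h) r \<in> span K \<longleftrightarrow> r \<in> span K" if "r \<in> \<Phi>" for r
    using g h that W_root[OF W(2)] by (auto simp: par_def)
  ultimately show ?thesis using W_comp[OF W] unfolding par_def by auto
qed

lemma par_reflection:
  assumes K: "K \<subseteq> \<Delta>" and k: "k \<in> K"
  shows "reflection k \<in> par K"
proof -
  have kD: "k \<in> \<Delta>" using K k by auto
  have W: "reflection k \<in> W" using kD simple_roots W_refl by auto
  have ks: "c *\<^sub>R k \<in> span K" for c using k by (simp add: span_base span_mul)
  have "reflection k r \<in> span K \<longleftrightarrow> r \<in> span K" for r
    unfolding reflection_def using ks[of "2 * (r \<bullet> k) / (k \<bullet> k)"] span_add_eq2 span_diff
    by (metis diff_add_cancel span_add)
  moreover have "reflection k r \<in> \<Phi>p" if "r \<in> \<Phi>p" "r \<notin> span K" for r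
    using reflection_simple[OF kD] that k span_base by blast
  ultimately show ?thesis using W by (auto simp: par_def inv_reflection)
qed

lemma X_span_pos:
  assumes K: "K \<subseteq> \<Delta>" and v: "v \<in> dist_reps n e K" and r: "r \<in> \<Phi>" "r \<in> span K"
  shows "v r \<in> \<Phi>p \<longleftrightarrow> r \<in> \<Phi>p"
proof -
  have vW: "v \<in> W" using v by (simp add: dist_reps_def)
  have *: "v s \<in> \<Phi>p" if s: "s \<in> \<Phi>p" "s \<in> span K" for s
  proof -
    obtain a b where ab: "s = e a - e b" "1 \<le> a" "a < b" "b \<le> n+1" using s by (elim posE)
    have "v s = (\<Sum>i\<in>{a..<b}. v (e i - e (i+1)))"
      using root_sum_simple[of a b] ab by (simp add: linear_sum[OF W_linear[OF vW]])
    moreover have "v (e i - e (i+1)) \<bullet> ht > 0" if "i \<in> {a..<b}" for i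
      using span_simple[OF K ab(2-4) _ that] s ab v by (auto simp: dist_reps_def pos_iff)
    ultimately have "v s \<bullet> ht > 0"
      using ab(3) by (simp add: inner_sum_left) (rule sum_pos, auto)
    then show ?thesis using W_root[OF vW] s by (simp add: pos_iff)
  qed
  show ?thesis
  proof
    assume "v r \<in> \<Phi>p"
    show "r \<in> \<Phi>p"
    proof (rule ccontr)
      assume "r \<notin> \<Phi>p"
      then have "- r \<in> \<Phi>p" using root_cases r by auto
      then have "v (- r) \<in> \<Phi>p" using * r span_neg by blast
      then show False using \<open>v r \<in> \<Phi>p\<close> by (simp add: linear_neg[OF W_linear[OF vW]] pos_iff)
    qed
  qed (use * r in auto)
qed

lemma coset_exists:
  assumes K: "K \<subseteq> \<Delta>" and w: "w \<in> W"
  shows "\<exists>g\<in>par K. w \<circ> g \<in> dist_reps n e K"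
proof -
  have fin: "finite (par K)" using finite_W by (rule finite_subset[rotated]) (auto simp: par_def)
  let ?f = "\<lambda>g. w (g ht) \<bullet> ht"
  obtain g where g: "g \<in> par K" and mx: "\<And>g'. g' \<in> par K \<Longrightarrow> ?f g' \<le> ?f g"
    using obtains_MAX[OF fin, of ?f] par_id by (metis (no_types, lifting) Max_ge empty_iff fin finite_imageI image_eqI)
  have wg: "w \<circ> g \<in> W" using W_comp w g par_W by blast
  have "w (g k) \<in> \<Phi>p" if k: "k \<in> K" for k
  proof (rule ccontr)
    assume n: "w (g k) \<notin> \<Phi>p"
    have kD: "k \<in> \<Delta>" "k \<in> \<Phi>" using k K simple_roots by auto
    have "w (g k) \<in> \<Phi>" using W_root[OF wg kD(2)] by simp
    then have "- w (g k) \<in> \<Phi>p" using n root_cases by blast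
    then have neg: "w (g k) \<bullet> ht < 0" by (simp add: pos_iff)
    have "reflection k ht = ht - k"
      unfolding reflection_def using root_norm[OF kD(2)] simple_ht[OF kD(1)] by (simp add: inner_commute)
    then have "?f (g \<circ> reflection k) = ?f g - w (g k) \<bullet> ht"
      using linear_diff[OF W_linear[OF wg]] by (simp add: inner_diff_left)
    moreover have "?f (g \<circ> reflection k) \<le> ?f g"
      by (rule mx) (rule par_comp[OF g par_reflection[OF K k]])
    ultimately show False using neg by simp
  qed
  then show ?thesis using g wg by (auto simp: dist_reps_def)
qed

lemma coset_unique:
  assumes K: "K \<subseteq> \<Delta>" and v: "v \<in> dist_reps n e K" and g: "g \<in> par K"
    and vg: "v \<circ> g \<in> dist_reps n e K"
  shows "g = id"
proof (rule W_pos_id)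
  show gW: "g \<in> W" using g par_W by auto
  fix s assume s: "s \<in> \<Delta>"
  then have sP: "s \<in> \<Phi>p" "s \<in> \<Phi>" using simple_pos simple_roots by auto
  show "g s \<in> \<Phi>p"
  proof (cases "s \<in> span K")
    case False
    then show ?thesis using g sP by (auto simp: par_def)
  next
    case True
    then have "(v \<circ> g) s \<in> \<Phi>p" using X_span_pos[OF K vg] sP by blast
    moreover have "g s \<in> span K" using g sP True by (auto simp: par_def)
    ultimately show ?thesis using X_span_pos[OF K v W_root[OF gW sP(2)]] by simp
  qed
qed

lemma double_simple:
  assumes K: "K \<subseteq> \<Delta>" and J: "J \<subseteq> \<Delta>" and w: "w \<in> dist_reps n e K" and wJ: "inv w ` J \<subseteq> \<Phi>p"
  shows "inv w ` J \<inter> span K = inv w ` J \<inter> K"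
proof (intro equalityI subsetI)
  fix r assume r: "r \<in> inv w ` J \<inter> span K"
  have wW: "w \<in> W" using w by (simp add: dist_reps_def)
  from r obtain s where s: "s \<in> J" "r = inv w s" by auto
  then have ws: "w r = s" using wW by simp
  have rP: "r \<in> \<Phi>p" using s wJ by auto
  then obtain a b where ab: "r = e a - e b" "1 \<le> a" "a < b" "b \<le> n+1" by (elim posE)
  have sub: "e i - e (i+1) \<in> K" if "i \<in> {a..<b}" for i
    using span_simple[OF K ab(2-4) _ that] r ab by auto
  have "1 = w r \<bullet> ht" using s J ws simple_ht by auto
  also have "w r = (\<Sum>i\<in>{a..<b}. w (e i - e (i+1)))"
    using root_sum_simple[of a b] ab by (simp add: linear_sum[OF W_linear[OF wW]])
  also have "\<dots> \<bullet> ht = (\<Sum>i\<in>{a..<b}. w (e i - e (i+1)) \<bullet> ht)" by (simp add: inner_sum_left)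
  also have "\<dots> \<ge> (\<Sum>i\<in>{a..<b}. 1)"
    by (rule sum_mono) (use sub w in \<open>auto intro!: pos_ht_ge1 simp: dist_reps_def\<close>)
  finally have "real (b - a) \<le> 1" by simp
  then have "b = a + 1" using ab by auto
  then show "r \<in> inv w ` J \<inter> K" using sub[of a] ab r by auto
qed (auto intro: span_base)

subsection \<open>Independence of representatives\<close>

lemma double_reps_iff:
  "w \<in> double_reps n e J K \<longleftrightarrow> w \<in> W \<and> inv w ` J \<subseteq> \<Phi>p \<and> w ` K \<subseteq> \<Phi>p"
proof
  assume "w \<in> double_reps n e J K"
  then obtain u where "u \<in> W" "u ` J \<subseteq> \<Phi>p" "w = inv u" "w \<in> W" "w ` K \<subseteq> \<Phi>p"
    by (auto simp: double_reps_def dist_reps_def)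
  then show "w \<in> W \<and> inv w ` J \<subseteq> \<Phi>p \<and> w ` K \<subseteq> \<Phi>p" by (simp add: inv_inv_eq W_bij)
next
  assume w: "w \<in> W \<and> inv w ` J \<subseteq> \<Phi>p \<and> w ` K \<subseteq> \<Phi>p"
  then have "inv w \<in> dist_reps n e J" "w = inv (inv w)"
    by (auto simp: dist_reps_def W_inv inv_inv_eq W_bij)
  then show "w \<in> double_reps n e J K" using w by (auto simp: double_reps_def dist_reps_def)
qed

lemma finite_double_reps [simp]: "finite (double_reps n e J K)"
  by (rule finite_subset[OF _ finite_W]) (auto simp: double_reps_iff)

lemma simple_conj_refl: "simple_conj n e J J"
  unfolding simple_conj_def using W_id by (intro bexI[of _ id]) auto

lemma simple_conj_sym: "simple_conj n e J K \<Longrightarrow> simple_conj n e K J"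
  unfolding simple_conj_def by (auto simp: image_image intro!: bexI[of _ "inv _"] W_inv)

lemma simple_conj_trans: "simple_conj n e J K \<Longrightarrow> simple_conj n e K L \<Longrightarrow> simple_conj n e J L"
  unfolding simple_conj_def using W_comp by (metis image_comp)

lemma desc_class_cong: "simple_conj n e J K \<Longrightarrow> desc_class n e J = desc_class n e K"
  unfolding desc_class_def using simple_conj_sym simple_conj_trans by blast

lemma double_transport:
  assumes J: "J \<subseteq> \<Delta>" "J' \<subseteq> \<Delta>" and K: "K \<subseteq> \<Delta>" and u: "u \<in> W" "u ` J = J'"
  obtains f where "inj_on f (double_reps n e J K)"
    and "\<And>w. w \<in> double_reps n e J K \<Longrightarrow> f w \<in> double_reps n e J' K \<and>
      simple_conj n e (inv w ` J \<inter> K) (inv (f w) ` J' \<inter> K)"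
proof -
  have "\<forall>w\<in>double_reps n e J K. \<exists>g\<in>par K. (u \<circ> w) \<circ> g \<in> dist_reps n e K"
    using coset_exists[OF K] W_comp[OF u(1)] by (auto simp: double_reps_iff)
  then obtain G where G: "\<And>w. w \<in> double_reps n e J K \<Longrightarrow> G w \<in> par K"
    and Gd: "\<And>w. w \<in> double_reps n e J K \<Longrightarrow> (u \<circ> w) \<circ> G w \<in> dist_reps n e K"
    by metis
  define f where "f = (\<lambda>w. (u \<circ> w) \<circ> G w)"
  have "inj_on f (double_reps n e J K)"
  proof (rule inj_onI)
    fix w w' assume w: "w \<in> double_reps n e J K" "w' \<in> double_reps n e J K" and eq: "f w = f w'"
    have W: "w \<in> W" "w' \<in> W" "G w \<in> W" "G w' \<in> W" using w G par_W by (auto simp: double_reps_iff)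
    let ?g = "G w \<circ> inv (G w')"
    have gp: "?g \<in> par K" using par_comp par_inv G w by blast
    have "w (?g x) = w' x" for x
    proof -
      have "u (w (G w (inv (G w') x))) = u (w' (G w' (inv (G w') x)))"
        using fun_cong[OF eq, of "inv (G w') x"] by (simp add: f_def)
      then show ?thesis using W_inv1[OF u(1)] W by (metis W_inv2 comp_apply)
    qed
    then have wg: "w \<circ> ?g = w'" by auto
    have "w \<in> dist_reps n e K" "w' \<in> dist_reps n e K" using w by (auto simp: double_reps_def)
    then have "?g = id" using coset_unique[OF K _ gp] wg by metis
    then show "w = w'" using wg by simp
  qed
  moreover have "f w \<in> double_reps n e J' K \<and>
      simple_conj n e (inv w ` J \<inter> K) (inv (f w) ` J' \<inter> K)"
    if w: "w \<in> double_reps n e J K" for w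
  proof -
    let ?g = "G w" and ?v = "f w"
    have W: "w \<in> W" "?g \<in> W" using w G par_W by (auto simp: double_reps_iff)
    have wJ: "inv w ` J \<subseteq> \<Phi>p" and wK: "w \<in> dist_reps n e K"
      using w by (simp_all add: double_reps_iff dist_reps_def)
    have vX: "?v \<in> dist_reps n e K" using Gd[OF w] by (simp add: f_def)
    then have vW: "?v \<in> W" by (simp add: dist_reps_def)
    have inv_v: "inv ?v (u s) = inv ?g (inv w s)" for s
    proof -
      have "?v (inv ?g (inv w s)) = u s" using W by (simp add: f_def)
      then show ?thesis using W_inv1[OF vW] by metis
    qed
    have vJ: "inv ?v ` J' = inv ?g ` (inv w ` J)"
      unfolding u(2)[symmetric] image_image by (simp add: inv_v)
    have "inv ?v ` J' \<subseteq> \<Phi>p"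
    proof
      fix r assume r: "r \<in> inv ?v ` J'"
      then obtain s where s: "s \<in> J" "r = inv ?g (inv w s)" unfolding vJ by blast
      have ws: "inv w s \<in> \<Phi>p" using s wJ by auto
      show "r \<in> \<Phi>p"
      proof (cases "inv w s \<in> span K")
        case False
        then show ?thesis using par_inv[OF G[OF w]] ws s by (auto simp: par_def)
      next
        case True
        have rP: "r \<in> \<Phi>" using s W_root[OF W_inv[OF W(2)]] ws pos_iff by auto
        have rK: "r \<in> span K" using par_span_inv[OF G[OF w]] True ws s pos_iff by auto
        have "?v r \<in> J'" using r vW by auto
        then have "?v r \<in> \<Phi>p" using J(2) simple_pos by auto
        then show ?thesis using X_span_pos[OF K vX rP rK] by simp
      qed
    qed
    moreover from this have "inv ?v ` J' \<inter> K = inv ?v ` J' \<inter> span K"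
      using double_simple[OF K J(2) vX] by simp
    moreover have "inv ?v ` J' \<inter> span K = inv ?g ` (inv w ` J \<inter> span K)"
    proof -
      have "inv ?g r \<in> span K \<longleftrightarrow> r \<in> span K" if "r \<in> inv w ` J" for r
        using par_span_inv[OF G[OF w], of r] that wJ pos_iff by blast
      then show ?thesis unfolding vJ by blast
    qed
    moreover have "inv w ` J \<inter> span K = inv w ` J \<inter> K"
      using double_simple[OF K J(1) wK wJ] .
    ultimately show ?thesis
      using vX W_inv[OF W(2)] by (auto simp: double_reps_iff dist_reps_def simple_conj_def)
  qed
  ultimately show thesis using that by blast
qed

definition cnt where
  "cnt J K C = card {w \<in> double_reps n e J K. desc_class n e (inv w ` J \<inter> K) = C}"

lemma cnt_le:
  assumes J: "J \<subseteq> \<Delta>" "J' \<subseteq> \<Delta>" and K: "K \<subseteq> \<Delta>" and c: "simple_conj n e J J'"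
  shows "cnt J K C \<le> cnt J' K C"
proof -
  obtain u where u: "u \<in> W" "u ` J = J'" using c by (auto simp: simple_conj_def)
  obtain f where f: "inj_on f (double_reps n e J K)"
    "\<And>w. w \<in> double_reps n e J K \<Longrightarrow> f w \<in> double_reps n e J' K \<and>
      simple_conj n e (inv w ` J \<inter> K) (inv (f w) ` J' \<inter> K)"
    using double_transport[OF J K u] by blast
  show ?thesis unfolding cnt_def
  proof (rule card_inj_on_le)
    show "inj_on f {w \<in> double_reps n e J K. desc_class n e (inv w ` J \<inter> K) = C}"
      using f(1) by (rule inj_on_subset) auto
    show "f ` {w \<in> double_reps n e J K. desc_class n e (inv w ` J \<inter> K) = C}
      \<subseteq> {w \<in> double_reps n e J' K. desc_class n e (inv w ` J' \<inter> K) = C}"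
      using f(2) desc_class_cong by blast
  qed simp
qed

lemma cnt_flip_le: "cnt J K C \<le> cnt K J C"
  unfolding cnt_def
proof (rule card_inj_on_le)
  show "inj_on inv {w \<in> double_reps n e J K. desc_class n e (inv w ` J \<inter> K) = C}"
    by (rule inj_on_inverseI[of _ inv]) (auto simp: double_reps_iff inv_inv_eq W_bij)
  show "inv ` {w \<in> double_reps n e J K. desc_class n e (inv w ` J \<inter> K) = C}
    \<subseteq> {w \<in> double_reps n e K J. desc_class n e (inv w ` K \<inter> J) = C}"
  proof clarify
    fix w assume w: "w \<in> double_reps n e J K"
    then have W: "w \<in> W" by (simp add: double_reps_iff)
    have "inv w \<in> double_reps n e K J"
      using w by (auto simp: double_reps_iff inv_inv_eq W_bij W_inv)
    moreover have "w ` (inv w ` J \<inter> K) = inv (inv w) ` K \<inter> J"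
      using W by (auto simp: inv_inv_eq W_bij) (metis IntI W_inv1 image_eqI)
    then have "simple_conj n e (inv w ` J \<inter> K) (inv (inv w) ` K \<inter> J)"
      using W by (auto simp: simple_conj_def)
    ultimately show "inv w \<in> double_reps n e K J \<and> desc_class n e (inv (inv w) ` K \<inter> J)
      = desc_class n e (inv w ` J \<inter> K)"
      using desc_class_cong by simp
  qed
qed simp

lemma cnt_cong:
  assumes "J \<subseteq> \<Delta>" "J' \<subseteq> \<Delta>" "K \<subseteq> \<Delta>" "K' \<subseteq> \<Delta>" "simple_conj n e J J'" "simple_conj n e K K'"
  shows "cnt J K C = cnt J' K' C"
proof -
  have "cnt J K C = cnt J' K C"
    using cnt_le assms simple_conj_sym by (meson antisym)
  also have "\<dots> = cnt K J' C" using cnt_flip_le by (meson antisym)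
  also have "\<dots> = cnt K' J' C" using cnt_le assms simple_conj_sym by (meson antisym)
  also have "\<dots> = cnt J' K' C" using cnt_flip_le by (meson antisym)
  finally show ?thesis .
qed

lemma lookup_desc_prod:
  assumes K: "K \<subseteq> \<Delta>"
  shows "Poly_Mapping.lookup (desc_prod n e J K) C = of_nat (cnt J K C)"
proof -
  have fK: "finite K" using finite_subset[OF K] by simp
  let ?S = "{L \<in> Pow K. desc_class n e L = C}"
  have "Poly_Mapping.lookup (desc_prod n e J K) C
    = (\<Sum>L\<in>Pow K. if desc_class n e L = C then of_nat (desc_coeff n e J K L) else 0)"
    unfolding desc_prod_def lookup_sum by (simp add: lookup_single when_def)
  also have "\<dots> = of_nat (\<Sum>L\<in>?S. desc_coeff n e J K L)"
    using fK sum.inter_filter[of "Pow K" "\<lambda>L. rat_of_nat (desc_coeff n e J K L)" "\<lambda>L. desc_class n e L = C"]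
    by simp
  also have "(\<Sum>L\<in>?S. desc_coeff n e J K L)
      = card (\<Union>L\<in>?S. {w \<in> double_reps n e J K. inv w ` J \<inter> K = L})"
    unfolding desc_coeff_def by (subst card_UN_disjoint) (use fK in auto)
  also have "(\<Union>L\<in>?S. {w \<in> double_reps n e J K. inv w ` J \<inter> K = L})
      = {w \<in> double_reps n e J K. desc_class n e (inv w ` J \<inter> K) = C}" by auto
  finally show ?thesis unfolding cnt_def .
qed

lemma dist_reps_inj:
  assumes J: "J \<subseteq> \<Delta>" and K: "K \<subseteq> \<Delta>" and eq: "dist_reps n e J = dist_reps n e K"
  shows "J = K"
proof -
  have *: "reflection s \<in> dist_reps n e M \<longleftrightarrow> s \<notin> M" if "s \<in> \<Delta>" "M \<subseteq> \<Delta>" for s M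
  proof -
    have sP: "s \<in> \<Phi>" "s \<in> \<Phi>p" using that simple_pos simple_roots by auto
    have "reflection s s = - s" unfolding reflection_def by (simp add: root_norm[OF sP(1)] scaleR_2)
    then have "reflection s s \<notin> \<Phi>p" using sP by (simp add: pos_iff)
    moreover have "reflection s t \<in> \<Phi>p" if "t \<in> M" "s \<notin> M" for t
      using reflection_simple[OF \<open>s \<in> \<Delta>\<close>, of t] that \<open>M \<subseteq> \<Delta>\<close> simple_pos by auto
    ultimately show ?thesis using W_refl[OF sP(1)] by (auto simp: dist_reps_def)
  qed
  then show ?thesis using J K eq by blast
qed

lemma desc_elt_inj:
  assumes "J \<subseteq> \<Delta>" "K \<subseteq> \<Delta>" "desc_elt n e J = desc_elt n e K"
  shows "J = K"
proof -
  have "Poly_Mapping.lookup (desc_elt n e M) w = (if w \<in> dist_reps n e M then 1 else 0)" for M w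
  proof -
    have "finite (dist_reps n e M)"
      by (rule finite_subset[OF _ finite_W]) (auto simp: dist_reps_def)
    then show ?thesis
      unfolding desc_elt_def lookup_sum by (simp add: lookup_single when_def)
  qed
  then have "w \<in> dist_reps n e J \<longleftrightarrow> w \<in> dist_reps n e K" for w
    using assms(3) by (metis zero_neq_one)
  then show ?thesis using dist_reps_inj[OF assms(1,2)] by blast
qed

lemma desc_class_eq_iff:
  assumes "J \<subseteq> \<Delta>" "K \<subseteq> \<Delta>"
  shows "desc_class n e J = desc_class n e K \<longleftrightarrow> simple_conj n e J K"
proof
  assume "desc_class n e J = desc_class n e K"
  moreover have "desc_elt n e J \<in> desc_class n e J"
    using assms simple_conj_refl by (auto simp: desc_class_def)
  ultimately obtain K' where "desc_elt n e J = desc_elt n e K'" "K' \<subseteq> \<Delta>" "simple_conj n e K' K"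
    unfolding desc_class_def by auto
  then show "simple_conj n e J K" using desc_elt_inj assms by blast
qed (rule desc_class_cong)

lemma new_descent_algebra_mult_basis:
  assumes J: "J \<subseteq> \<Delta>" and K: "K \<subseteq> \<Delta>"
  shows "Poly_Mapping.single (desc_class n e J) 1 \<otimes>\<^bsub>new_descent_algebra n e\<^esub>
      Poly_Mapping.single (desc_class n e K) 1
    = (\<Sum>L\<in>Pow K. Poly_Mapping.single (desc_class n e L) (of_nat (desc_coeff n e J K L)))"
proof -
  have rep: "desc_rep n e (desc_class n e M) \<subseteq> \<Delta> \<and> simple_conj n e (desc_rep n e (desc_class n e M)) M"
    if "M \<subseteq> \<Delta>" for M
  proof -
    have "desc_rep n e (desc_class n e M) \<subseteq> \<Delta> \<and>
        desc_class n e (desc_rep n e (desc_class n e M)) = desc_class n e M"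
      unfolding desc_rep_def by (rule someI[of _ M]) (use that in auto)
    then show ?thesis using desc_class_eq_iff that by blast
  qed
  have "desc_prod n e (desc_rep n e (desc_class n e J)) (desc_rep n e (desc_class n e K))
      = desc_prod n e J K"
    by (rule poly_mapping_eqI)
      (use rep[OF J] rep[OF K] J K cnt_cong in \<open>simp add: lookup_desc_prod\<close>)
  moreover have "desc_scale 1 p = p" for p :: "'c \<Rightarrow>\<^sub>0 rat"
    unfolding desc_scale_def
    by (rule poly_mapping_eqI) (simp add: Poly_Mapping.map.rep_eq when_def)
  ultimately show ?thesis
    by (simp add: new_descent_algebra_def lookup_single) (simp add: desc_prod_def)
qed

end

end

theory Submission
  imports Defs
begin

text \<open>By \<open>lookup_desc_prod\<close>, the coefficient of a class \<open>C\<close> in \<open>[x_J][x_K]\<close> is the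
  number \<open>cnt J K C\<close> of \<open>w \<in> X_{JK}\<close> for which \<open>w\<^sup>-\<^sup>1(J) \<inter> K\<close> has class \<open>C\<close>. Inversion is a
  bijection from \<open>X_{JK}\<close> to \<open>X_{KJ}\<close>, and it preserves that class, because \<open>w\<close> carries
  \<open>w\<^sup>-\<^sup>1(J) \<inter> K\<close> onto \<open>J \<inter> w(K)\<close>; so \<open>cnt J K C = cnt K J C\<close> (one inequality is
  \<open>cnt_flip_le\<close>, the other is its mirror image). Passing from subsets of \<open>\<Delta>\<close> to their
  classes is what makes the structure constants symmetric: \<open>w\<^sup>-\<^sup>1(J) \<inter> K\<close> and \<open>J \<inter> w(K)\<close>
  are in general different sets. Commutativity on basis elements extends bilinearly.\<close>

context type_A_basis
begin

lemma desc_prod_commute: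
  assumes "J \<subseteq> \<Delta>" "K \<subseteq> \<Delta>"
  shows "desc_prod n e J K = desc_prod n e K J"
proof (rule poly_mapping_eqI)
  fix C
  have "cnt J K C = cnt K J C"
    using cnt_flip_le by (rule antisym) (rule cnt_flip_le)
  then show "Poly_Mapping.lookup (desc_prod n e J K) C = Poly_Mapping.lookup (desc_prod n e K J) C"
    using assms by (simp add: lookup_desc_prod)
qed

text \<open>The product evaluates \<open>desc_prod\<close> at chosen representatives, and \<open>desc_prod_commute\<close>
  applies to them only once they are known to consist of simple roots.\<close>

lemma desc_rep_subset:
  assumes "A \<in> desc_classes n e"
  shows "desc_rep n e A \<subseteq> \<Delta>"
proof -
  have "\<exists>J. J \<subseteq> \<Delta> \<and> desc_class n e J = A"
    using assms by (auto simp: desc_classes_def)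
  then show ?thesis unfolding desc_rep_def by (rule someI2_ex) simp
qed

lemma new_descent_algebra_commute:
  assumes p: "p \<in> carrier (new_descent_algebra n e)" and q: "q \<in> carrier (new_descent_algebra n e)"
  shows "p \<otimes>\<^bsub>new_descent_algebra n e\<^esub> q = q \<otimes>\<^bsub>new_descent_algebra n e\<^esub> p"
proof -
  let ?term = "\<lambda>p q A B. desc_scale (Poly_Mapping.lookup p A * Poly_Mapping.lookup q B)
    (desc_prod n e (desc_rep n e A) (desc_rep n e B))"
  have "?term p q A B = ?term q p B A"
    if "A \<in> Poly_Mapping.keys p" "B \<in> Poly_Mapping.keys q" for A B
  proof -
    have "A \<in> desc_classes n e" "B \<in> desc_classes n e"
      using that p q by (auto simp: new_descent_algebra_def)
    then show ?thesis
      using desc_prod_commute[OF desc_rep_subset desc_rep_subset] by (simp add: mult.commute)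
  qed
  then have "(\<Sum>A\<in>Poly_Mapping.keys p. \<Sum>B\<in>Poly_Mapping.keys q. ?term p q A B)
      = (\<Sum>A\<in>Poly_Mapping.keys p. \<Sum>B\<in>Poly_Mapping.keys q. ?term q p B A)"
    by (intro sum.cong refl)
  also have "\<dots> = (\<Sum>B\<in>Poly_Mapping.keys q. \<Sum>A\<in>Poly_Mapping.keys p. ?term q p B A)"
    by (rule sum.swap)
  finally show ?thesis by (simp add: new_descent_algebra_def)
qed

end

theorem proposition2p7:
  fixes n :: nat and e :: "nat \<Rightarrow> 'a::euclidean_space"
  assumes "n \<ge> 1"
    and "DIM('a) = n + 1"
    and "\<forall>i\<in>{1..n+1}. \<forall>j\<in>{1..n+1}. e i \<bullet> e j = (if i = j then 1 else 0)"
  shows "\<forall>x\<in>carrier (new_descent_algebra n e). \<forall>y\<in>carrier (new_descent_algebra n e).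
    x \<otimes>\<^bsub>new_descent_algebra n e\<^esub> y = y \<otimes>\<^bsub>new_descent_algebra n e\<^esub> x"
proof -
  interpret type_A_basis n e
    by unfold_locales (use assms in blast)+
  show ?thesis using new_descent_algebra_commute by blast
qed

end
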